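(* Assume that there are constants $C\ge 1$, $\mathcal{Q}\ge 1$ and non-negative numbers $q_{i,k}$ ($1\le k\le i$) such that $\sum_{k=1}^i k(i-k+1)q_{i,k}\le \mathcal{Q}\,i$ for all $i\in\mathbb{N}_+$, and $a(i,j;k)\le C(i-k+1)(j+k)q_{i,k}$ for all integers $1\le k\le i$ and all $j\in\mathbb{N}_+$. Let $c^{\mathrm{in}}=(c^{\mathrm{in}}_i)_{i\ge 0}\in X_{0,1}^+$ and let $c=(c_i)_{i\ge0}$ be an admissible solution of the initial value problem for the DGED system in the isolated case with initial condition $c(0)=c^{\mathrm{in}}$. Then, for all $t\ge 0$, $$\sum_{i=0}^\infty c_i(t)=\sum_{i=0}^\infty c^{\mathrm{in}}_i\qquad\text{and}\qquad \sum_{i=0}^\infty i\,c_i(t)=\sum_{i=0}^\infty i\,c^{\mathrm{in}}_i .$$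
   Context: Notation: $\mathbb{N}=\{0,1,2,\dots\}$, $\mathbb{N}_+=\mathbb{N}\setminus\{0\}$. Rate coefficients: real numbers $a(p,q;k)\ge 0$ are given for all integers $p\ge1$, $q\ge 0$, $1\le k\le p$. Standing assumptions: $a(p,0;p)=0$ for all $p\in\mathbb{N}_+$; $a(k,j;k)=a(j,k;j)$ for all $j,k\in\mathbb{N}_+$; $a(i,0;k)=a(i,0;i-k)$ for all $i\in\mathbb{N}_+$, $1\le k\le i-1$. Discrete generalized exchange-driven (DGED) system, isolated case: $\dot c_i=\sum_{j=1}^4 Q_{j,i}(c)$, $i\in\mathbb{N}$, where $$Q_{1,i}(c)=\sum_{k=1}^\infty\sum_{j=0}^\infty a(i+k,j;k)c_{i+k}c_j,\qquad Q_{2,i}(c)=-\sum_{k=1}^\infty\sum_{j=k}^\infty a(j,i;k)c_jc_i,$$ $$Q_{3,i}(c)=\sum_{k=1}^i\sum_{j=k}^\infty a(j,i-k;k)c_jc_{i-k},\qquad Q_{4,i}(c)=-\sum_{k=1}^i\sum_{j=0}^\infty a(i,j;k)c_jc_i,$$ with $Q_{3,0}=Q_{4,0}=0$. Spaces: $X_{0,1}=\{c:\mathbb{N}\to\mathbb{R} : \|c\|:=\sum_{i=0}^\infty(1+i)|c_i|<\infty\}$, $X_{0,1}^+=\{c\in X_{0,1}: c_i\ge 0\ \forall i\}$. Mild solution: for $T\in(0,+\infty]$, a (mild) solution on $[0,T)$ with initial condition $c^{\mathrm{in}}\in X_{0,1}^+$ is a sequence of nonnegative functions $c=(c_i):[0,T)\to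 X_{0,1}^+$ such that for each $i\in\mathbb{N}$ and $t\in(0,T)$: (i) $c_i\in C^0([0,T))$; (ii) $Q_{j,i}(c(\cdot))\in L^1(0,t)$ for $j=1,2,3,4$; (iii) $c_i(t)=c^{\mathrm{in}}_i+\int_0^t\sum_{j=1}^4Q_{j,i}(c(s))\,ds$. Truncated system ($N$-DGED), isolated case: for $N\ge 1$, the ODE system in $\mathbb{R}^{N+1}$ given by $\dot c_i=\sum_{j=1}^4Q^N_{j,i}(c)$, $0\le i\le N$, where (empty sums being zero) $$Q^N_{1,i}(c)=\sum_{k=1}^{N-i}\sum_{j=0}^{N-k}a(i+k,j;k)c_{i+k}c_j,\qquad Q^N_{2,i}(c)=-\sum_{k=1}^{N-i}\sum_{j=k}^{N}a(j,i;k)c_jc_i,$$ $$Q^N_{3,i}(c)=\sum_{k=1}^{i}\sum_{j=k}^{N}a(j,i-k;k)c_jc_{i-k},\qquad Q^N_{4,i}(c)=-\sum_{k=1}^{i}\sum_{j=0}^{N-k}a(i,j;k)c_jc_i .$$ Denote by $c^N=(c^N_i)_{0\le i\le N}$ its (unique, nonnegative, global) solution with $c^N_i(0)=c^{\mathrm{in}}_i$, $0\le i\le N$. Admissible solution: a mild solution $c$ on $[0,\infty)$ with initial condition $c^{\mathrm{in}}$ which is obtained as a limit of solutions of the truncated systems, i.e. there is a strictly increasing sequence of integers $N$ along which $c^N_i(t)\to c_i(t)$ as $N\to\infty$ for every $i\in\mathbb{N}$ and every $t\in[0,\infty)$. *)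

theory Defs
  imports "HOL-Analysis.Analysis"
begin

text \<open>
  The coefficient \<open>a(p,q;k)\<close> is written \<open>a p q k\<close>. It is meaningful for \<open>1 \<le> k \<le> p\<close> only; values
  outside this range are unconstrained and are never used below.
\<close>

definition rate_coefficients :: "(nat \<Rightarrow> nat \<Rightarrow> nat \<Rightarrow> real) \<Rightarrow> bool" where
  "rate_coefficients a \<longleftrightarrow>
     (\<forall>p q k. 1 \<le> k \<and> k \<le> p \<longrightarrow> 0 \<le> a p q k) \<and>
     (\<forall>p\<ge>1. a p 0 p = 0) \<and>
     (\<forall>j\<ge>1. \<forall>k\<ge>1. a k j k = a j k j) \<and>
     (\<forall>i\<ge>1. \<forall>k. 1 \<le> k \<and> k \<le> i - 1 \<longrightarrow> a i 0 k = a i 0 (i - k))"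

definition X01 :: "(nat \<Rightarrow> real) set" where
  "X01 = {c. summable (\<lambda>i. (1 + real i) * \<bar>c i\<bar>)}"

definition X01_plus :: "(nat \<Rightarrow> real) set" where
  "X01_plus = {c \<in> X01. \<forall>i. 0 \<le> c i}"

definition Q1 :: "(nat \<Rightarrow> nat \<Rightarrow> nat \<Rightarrow> real) \<Rightarrow> nat \<Rightarrow> (nat \<Rightarrow> real) \<Rightarrow> real" where
  "Q1 a i c = (\<Sum>\<^sub>\<infinity>k\<in>{1..}. \<Sum>\<^sub>\<infinity>j\<in>{0..}. a (i + k) j k * c (i + k) * c j)"

definition Q2 :: "(nat \<Rightarrow> nat \<Rightarrow> nat \<Rightarrow> real) \<Rightarrow> nat \<Rightarrow> (nat \<Rightarrow> real) \<Rightarrow> real" where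
  "Q2 a i c = - (\<Sum>\<^sub>\<infinity>k\<in>{1..}. \<Sum>\<^sub>\<infinity>j\<in>{k..}. a j i k * c j * c i)"

definition Q3 :: "(nat \<Rightarrow> nat \<Rightarrow> nat \<Rightarrow> real) \<Rightarrow> nat \<Rightarrow> (nat \<Rightarrow> real) \<Rightarrow> real" where
  "Q3 a i c = (\<Sum>k=1..i. \<Sum>\<^sub>\<infinity>j\<in>{k..}. a j (i - k) k * c j * c (i - k))"

definition Q4 :: "(nat \<Rightarrow> nat \<Rightarrow> nat \<Rightarrow> real) \<Rightarrow> nat \<Rightarrow> (nat \<Rightarrow> real) \<Rightarrow> real" where
  "Q4 a i c = - (\<Sum>k=1..i. \<Sum>\<^sub>\<infinity>j\<in>{0..}. a i j k * c j * c i)"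

text \<open>
  Since \<^const>\<open>infsum\<close> is \<open>0\<close> on families that are not summable, finiteness of the four series is
  recorded separately. For nonnegative \<open>c\<close> all terms are nonnegative, so summability of the double
  families is the same as convergence of the iterated series above.
\<close>

definition Q_finite :: "(nat \<Rightarrow> nat \<Rightarrow> nat \<Rightarrow> real) \<Rightarrow> nat \<Rightarrow> (nat \<Rightarrow> real) \<Rightarrow> bool" where
  "Q_finite a i c \<longleftrightarrow>
     (\<lambda>(k, j). a (i + k) j k * c (i + k) * c j) summable_on (SIGMA k:{1..}. {0..}) \<and>
     (\<lambda>(k, j). a j i k * c j * c i) summable_on (SIGMA k:{1..}. {k..}) \<and>
     (\<forall>k\<in>{1..i}. (\<lambda>j. a j (i - k) k * c j * c (i - k)) summable_on {k..}) \<and>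
     (\<forall>k\<in>{1..i}. (\<lambda>j. a i j k * c j * c i) summable_on {0..})"

text \<open>
  Functions of time are represented as \<open>c t i\<close>, with \<open>t\<close> the time and \<open>i\<close> the index; only
  their values on \<open>[0,T)\<close> matter. That the functions \<open>Q\<^sub>j\<^sub>,\<^sub>i(c(\<cdot>))\<close> lie in \<open>L\<^sup>1(0,t)\<close> includes that the
  series defining them are finite almost everywhere.
\<close>

definition mild_solution ::
  "(nat \<Rightarrow> nat \<Rightarrow> nat \<Rightarrow> real) \<Rightarrow> ereal \<Rightarrow> (nat \<Rightarrow> real) \<Rightarrow> (real \<Rightarrow> nat \<Rightarrow> real) \<Rightarrow> bool" where
  "mild_solution a T cin c \<longleftrightarrow>
     0 < T \<and> cin \<in> X01_plus \<and>
     (\<forall>t. 0 \<le> t \<and> ereal t < T \<longrightarrow> c t \<in> X01_plus) \<and>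
     (\<forall>i. continuous_on {t. 0 \<le> t \<and> ereal t < T} (\<lambda>t. c t i)) \<and>
     (\<forall>i t. 0 < t \<and> ereal t < T \<longrightarrow>
        (AE s in lborel. s \<in> {0<..<t} \<longrightarrow> Q_finite a i (c s)) \<and>
        set_integrable lborel {0<..<t} (\<lambda>s. Q1 a i (c s)) \<and>
        set_integrable lborel {0<..<t} (\<lambda>s. Q2 a i (c s)) \<and>
        set_integrable lborel {0<..<t} (\<lambda>s. Q3 a i (c s)) \<and>
        set_integrable lborel {0<..<t} (\<lambda>s. Q4 a i (c s)) \<and>
        c t i = cin i + (LBINT s:{0<..<t}.
                           Q1 a i (c s) + Q2 a i (c s) + Q3 a i (c s) + Q4 a i (c s)))"

definition QN1 :: "(nat \<Rightarrow> nat \<Rightarrow> nat \<Rightarrow> real) \<Rightarrow> nat \<Rightarrow> nat \<Rightarrow> (nat \<Rightarrow> real) \<Rightarrow> real" where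
  "QN1 a N i c = (\<Sum>k=1..N - i. \<Sum>j=0..N - k. a (i + k) j k * c (i + k) * c j)"

definition QN2 :: "(nat \<Rightarrow> nat \<Rightarrow> nat \<Rightarrow> real) \<Rightarrow> nat \<Rightarrow> nat \<Rightarrow> (nat \<Rightarrow> real) \<Rightarrow> real" where
  "QN2 a N i c = - (\<Sum>k=1..N - i. \<Sum>j=k..N. a j i k * c j * c i)"

definition QN3 :: "(nat \<Rightarrow> nat \<Rightarrow> nat \<Rightarrow> real) \<Rightarrow> nat \<Rightarrow> nat \<Rightarrow> (nat \<Rightarrow> real) \<Rightarrow> real" where
  "QN3 a N i c = (\<Sum>k=1..i. \<Sum>j=k..N. a j (i - k) k * c j * c (i - k))"

definition QN4 :: "(nat \<Rightarrow> nat \<Rightarrow> nat \<Rightarrow> real) \<Rightarrow> nat \<Rightarrow> nat \<Rightarrow> (nat \<Rightarrow> real) \<Rightarrow> real" where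
  "QN4 a N i c = - (\<Sum>k=1..i. \<Sum>j=0..N - k. a i j k * c j * c i)"

text \<open>
  An element of \<open>\<real>\<^sup>N\<^sup>+\<^sup>1\<close> is represented by the values at \<open>0, \<dots>, N\<close> of a function on the naturals; the
  remaining values are unconstrained and do not enter the right-hand sides for \<open>i \<le> N\<close>. For
  nonnegative initial data the global solution is unique (the vector field is polynomial) and
  nonnegative.
\<close>

definition truncated_solution ::
  "(nat \<Rightarrow> nat \<Rightarrow> nat \<Rightarrow> real) \<Rightarrow> nat \<Rightarrow> (nat \<Rightarrow> real) \<Rightarrow> (real \<Rightarrow> nat \<Rightarrow> real) \<Rightarrow> bool" where
  "truncated_solution a N cin u \<longleftrightarrow>
     (\<forall>i\<le>N. u 0 i = cin i) \<and>
     (\<forall>i\<le>N. \<forall>t\<ge>0. ((\<lambda>s. u s i) has_real_derivative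
        QN1 a N i (u t) + QN2 a N i (u t) + QN3 a N i (u t) + QN4 a N i (u t)) (at t within {0..}))"

definition admissible_solution ::
  "(nat \<Rightarrow> nat \<Rightarrow> nat \<Rightarrow> real) \<Rightarrow> (nat \<Rightarrow> real) \<Rightarrow> (real \<Rightarrow> nat \<Rightarrow> real) \<Rightarrow> bool" where
  "admissible_solution a cin c \<longleftrightarrow>
     mild_solution a \<infinity> cin c \<and>
     (\<exists>(N :: nat \<Rightarrow> nat) (u :: nat \<Rightarrow> real \<Rightarrow> nat \<Rightarrow> real).
        strict_mono N \<and>
        (\<forall>m. 1 \<le> N m \<and> truncated_solution a (N m) cin (u m)) \<and>
        (\<forall>i. \<forall>t\<ge>0. (\<lambda>m. u m t i) \<longlonglongrightarrow> c t i))"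

end

theory Submission
  imports Defs
begin

text \<open>
  Only the approximating truncated solutions matter. They conserve both moments, so it suffices to
  bound the tails of their first moments uniformly in the truncation. For this, test the system with
  the weight \<open>g\<^sub>n(x) = x\<^sup>2 / (x + n)\<close>. It is superadditive, so transfers to empty
  clusters (whose rates are unbounded) do not increase \<open>\<Sum> g\<^sub>n(i) c\<^sub>i\<close>, and it satisfies
  \<open>(x + y) (g\<^sub>n(x + y) - g\<^sub>n(x) - g\<^sub>n(y)) \<le> 2 (x g\<^sub>n(y) + y g\<^sub>n(x))\<close>, so the growth of the rates
  is absorbed by a Gronwall estimate whose constant depends neither on \<open>n\<close> nor on the truncation.
  As \<open>x/2 \<le> g\<^sub>n(x)\<close> for \<open>x \<ge> n\<close>, while \<open>\<Sum> g\<^sub>n(i) c\<^sub>i\<close> tends to \<open>0\<close> at time \<open>0\<close> as \<open>n\<close>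
  grows, the tails are uniformly small at any later time.
\<close>

section \<open>Real analysis\<close>

text \<open>\<open>f t * exp (- K * t)\<close> is nonincreasing. The derivative is one-sided at
  \<open>0\<close>, as for truncated solutions, and the inequality is asked for only strictly
  between \<open>0\<close> and \<open>T\<close>, so that \<open>K\<close> may depend on
  \<open>T\<close>.\<close>

lemma gronwall_nonneg_time:
  fixes f f' :: "real \<Rightarrow> real"
  assumes deriv: "\<And>t. 0 \<le> t \<Longrightarrow> (f has_real_derivative f' t) (at t within {0..})"
    and le: "\<And>t. 0 < t \<Longrightarrow> t < T \<Longrightarrow> f' t \<le> K * f t"
    and "0 \<le> T"
  shows "f T \<le> f 0 * exp (K * T)"
proof -
  define h where "h t = f t * exp (- K * t)" for t
  have hd: "(h has_real_derivative (f' t - K * f t) * exp (- K * t)) (at t within {0..})"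
    if "0 \<le> t" for t
    unfolding h_def
    by (rule derivative_eq_intros deriv[OF that] refl | simp add: algebra_simps)+
  have "continuous_on {0..} h"
    using hd by (auto simp: continuous_on_eq_continuous_within intro: DERIV_continuous)
  then have cont: "continuous_on {0..T} h"
    by (rule continuous_on_subset) auto
  have "h T \<le> h 0"
  proof (rule DERIV_nonpos_imp_decreasing_open[OF \<open>0 \<le> T\<close> _ cont])
    fix t :: real assume t: "0 < t" "t < T"
    have "at t within {0..} = at t"
      using t by (intro at_within_interior) auto
    with hd[of t] t have "(h has_real_derivative (f' t - K * f t) * exp (- K * t)) (at t)"
      by simp
    moreover have "(f' t - K * f t) * exp (- K * t) \<le> 0"
      using le[OF t] by (intro mult_nonpos_nonneg) auto
    ultimately show "\<exists>y. (h has_real_derivative y) (at t) \<and> y \<le> 0" by blast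
  qed
  then have "f T * exp (- K * T) * exp (K * T) \<le> f 0 * exp (K * T)"
    by (simp add: h_def)
  then show ?thesis
    by (simp add: mult.assoc flip: exp_add)
qed

text \<open>The squared negative part is continuously differentiable, so it can be tested along a
  solution of unknown sign. At \<open>0\<close> the difference quotient is at most
  \<open>\<bar>h\<bar>\<close> in absolute value.\<close>

lemma has_real_derivative_min_0_square:
  fixes x :: real
  shows "((\<lambda>y. (min y 0)\<^sup>2) has_real_derivative 2 * min x 0) (at x)"
proof (cases x "0::real" rule: linorder_cases)
  case less
  have "((\<lambda>y. y\<^sup>2) has_real_derivative 2 * min x 0) (at x)"
    using less by (auto intro!: derivative_eq_intros)
  then show ?thesis
    by (rule has_field_derivative_transform_within_open[where S = "{..<0}"]) (use less in auto)
next
  case equal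
  have "((\<lambda>h::real. (min h 0)\<^sup>2 / h) \<longlongrightarrow> 0) (at 0)"
  proof (rule Lim_null_comparison)
    have "norm ((min h 0)\<^sup>2 / h) \<le> \<bar>h\<bar>" for h :: real
      by (cases "h = 0") (auto simp: min_def power2_eq_square)
    then show "\<forall>\<^sub>F h in at 0. norm ((min h 0)\<^sup>2 / h) \<le> \<bar>h::real\<bar>"
      by simp
    show "((\<lambda>h. \<bar>h::real\<bar>) \<longlongrightarrow> 0) (at 0)"
      using tendsto_rabs[OF tendsto_ident_at, of "0::real" UNIV] by simp
  qed
  then show ?thesis
    using equal by (simp add: DERIV_def)
next
  case greater
  have "((\<lambda>y. 0) has_real_derivative 2 * min x 0) (at x)"
    using greater by simp
  then show ?thesis
    by (rule has_field_derivative_transform_within_open[where S = "{0<..}"]) (use greater in auto)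
qed

section \<open>The truncated system tested against a weight\<close>

abbreviation QN :: "(nat \<Rightarrow> nat \<Rightarrow> nat \<Rightarrow> real) \<Rightarrow> nat \<Rightarrow> nat \<Rightarrow> (nat \<Rightarrow> real) \<Rightarrow> real" where
  "QN a N i c \<equiv> QN1 a N i c + QN2 a N i c + QN3 a N i c + QN4 a N i c"

text \<open>
  The triple \<open>(k, p, j)\<close> stands for the transfer of \<open>k\<close> units from a cluster of size \<open>p\<close> to one
  of size \<open>j\<close>.
\<close>

definition exchanges :: "nat \<Rightarrow> (nat \<times> nat \<times> nat) set" where
  "exchanges N = (SIGMA k:{1..N}. {k..N} \<times> {0..N - k})"

lemma finite_exchanges [simp]: "finite (exchanges N)"
  by (simp add: exchanges_def)

lemma mem_exchanges: "(k, p, j) \<in> exchanges N \<longleftrightarrow> 1 \<le> k \<and> k \<le> p \<and> p \<le> N \<and> j + k \<le> N"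
  by (auto simp: exchanges_def)

text \<open>In this sum \<open>i\<close> is what remains of the donor, so \<open>p = i + k\<close>.
  The truncation bounds are such that this sum and the three below all run over the same set
  \<open>exchanges N\<close> once reindexed.\<close>

lemma QN1_weak:
  "(\<Sum>i\<le>N. g i * QN1 a N i u) = (\<Sum>(k, p, j)\<in>exchanges N. a p j k * u p * u j * g (p - k))"
proof -
  have "(\<Sum>i\<le>N. g i * QN1 a N i u) =
      (\<Sum>(i, k, j)\<in>(SIGMA i:{..N}. SIGMA k:{1..N - i}. {0..N - k}).
         g i * (a (i + k) j k * u (i + k) * u j))"
    by (simp add: QN1_def sum_distrib_left sum.Sigma case_prod_unfold)
  also have "\<dots> = (\<Sum>(k, p, j)\<in>exchanges N. a p j k * u p * u j * g (p - k))"
    by (rule sum.reindex_bij_witness[where i = "\<lambda>(k, p, j). (p - k, k, j)"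
          and j = "\<lambda>(i, k, j). (k, i + k, j)"])
       (auto simp: mem_exchanges)
  finally show ?thesis .
qed

lemma QN2_weak:
  "(\<Sum>i\<le>N. g i * QN2 a N i u) = - (\<Sum>(k, p, j)\<in>exchanges N. a p j k * u p * u j * g j)"
proof -
  have "(\<Sum>i\<le>N. g i * QN2 a N i u) =
      - (\<Sum>(i, k, j)\<in>(SIGMA i:{..N}. SIGMA k:{1..N - i}. {k..N}). g i * (a j i k * u j * u i))"
    by (simp add: QN2_def sum_distrib_left sum.Sigma case_prod_unfold sum_negf)
  also have "(\<Sum>(i, k, j)\<in>(SIGMA i:{..N}. SIGMA k:{1..N - i}. {k..N}). g i * (a j i k * u j * u i))
      = (\<Sum>(k, p, j)\<in>exchanges N. a p j k * u p * u j * g j)"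
    by (rule sum.reindex_bij_witness[where i = "\<lambda>(k, p, j). (j, k, p)"
          and j = "\<lambda>(i, k, j). (k, j, i)"])
       (auto simp: mem_exchanges)
  finally show ?thesis .
qed

lemma QN3_weak:
  "(\<Sum>i\<le>N. g i * QN3 a N i u) = (\<Sum>(k, p, j)\<in>exchanges N. a p j k * u p * u j * g (j + k))"
proof -
  have "(\<Sum>i\<le>N. g i * QN3 a N i u) =
      (\<Sum>(i, k, j)\<in>(SIGMA i:{..N}. SIGMA k:{1..i}. {k..N}).
         g i * (a j (i - k) k * u j * u (i - k)))"
    by (simp add: QN3_def sum_distrib_left sum.Sigma case_prod_unfold)
  also have "\<dots> = (\<Sum>(k, p, j)\<in>exchanges N. a p j k * u p * u j * g (j + k))"
    by (rule sum.reindex_bij_witness[where i = "\<lambda>(k, p, j). (j + k, k, p)"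
          and j = "\<lambda>(i, k, j). (k, j, i - k)"])
       (auto simp: mem_exchanges)
  finally show ?thesis .
qed

lemma QN4_weak:
  "(\<Sum>i\<le>N. g i * QN4 a N i u) = - (\<Sum>(k, p, j)\<in>exchanges N. a p j k * u p * u j * g p)"
proof -
  have "(\<Sum>i\<le>N. g i * QN4 a N i u) =
      - (\<Sum>(i, k, j)\<in>(SIGMA i:{..N}. SIGMA k:{1..i}. {0..N - k}). g i * (a i j k * u j * u i))"
    by (simp add: QN4_def sum_distrib_left sum.Sigma case_prod_unfold sum_negf)
  also have "(\<Sum>(i, k, j)\<in>(SIGMA i:{..N}. SIGMA k:{1..i}. {0..N - k}). g i * (a i j k * u j * u i))
      = (\<Sum>(k, p, j)\<in>exchanges N. a p j k * u p * u j * g p)"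
    by (rule sum.reindex_bij_witness[where i = "\<lambda>(k, p, j). (p, k, j)"
          and j = "\<lambda>(i, k, j). (k, i, j)"])
       (auto simp: mem_exchanges)
  finally show ?thesis .
qed

text \<open>Weak form of the system: an exchange turns the pair of sizes \<open>p\<close>,
  \<open>j\<close> into \<open>p - k\<close>, \<open>j + k\<close>. Conservation, nonnegativity and
  the tail estimate all come from choices of \<open>g\<close> here.\<close>

lemma QN_weak:
  "(\<Sum>i\<le>N. g i * QN a N i u) =
     (\<Sum>(k, p, j)\<in>exchanges N. a p j k * u p * u j * (g (p - k) + g (j + k) - g p - g j))"
  by (simp add: distrib_left sum.distrib QN1_weak QN2_weak QN3_weak QN4_weak right_diff_distrib
      sum_subtractf case_prod_unfold)

section \<open>Conservation laws and boundedness on compact time intervals\<close>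

context
  fixes a N cin u
  assumes sol: "truncated_solution a N cin u"
begin

lemma truncated_initial: "i \<le> N \<Longrightarrow> u 0 i = cin i"
  using sol by (simp add: truncated_solution_def)

lemma truncated_deriv:
  "i \<le> N \<Longrightarrow> 0 \<le> t \<Longrightarrow> ((\<lambda>s. u s i) has_real_derivative QN a N i (u t)) (at t within {0..})"
  using sol by (simp add: truncated_solution_def)

lemma truncated_moment_deriv:
  assumes "0 \<le> t"
  shows "((\<lambda>s. \<Sum>i\<le>N. g i * u s i) has_real_derivative (\<Sum>i\<le>N. g i * QN a N i (u t)))
           (at t within {0..})"
  by (intro DERIV_sum DERIV_cmult truncated_deriv assms) auto

text \<open>Every bracket in the weak form vanishes. The weights of interest are the constant
  \<open>1\<close> (number of clusters, empty ones included) and the size itself (mass).\<close>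

lemma truncated_conserves:
  assumes balance: "\<And>k p j. 1 \<le> k \<Longrightarrow> k \<le> p \<Longrightarrow> g (p - k) + g (j + k) = g p + g j"
    and "0 \<le> t"
  shows "(\<Sum>i\<le>N. g i * u t i) = (\<Sum>i\<le>N. g i * cin i)"
proof -
  have "(\<Sum>i\<le>N. g i * QN a N i (u s)) = 0" for s
    unfolding QN_weak by (intro sum.neutral) (auto simp: mem_exchanges balance)
  then have d: "((\<lambda>s. \<Sum>i\<le>N. g i * u s i) has_real_derivative 0) (at s within {0..})" if "0 \<le> s" for s
    using truncated_moment_deriv[OF that, of g] by simp
  have "(\<Sum>i\<le>N. g i * u t i) = (\<Sum>i\<le>N. g i * u 0 i)"
    by (rule has_field_derivative_zero_constant[of "{0..}", THEN exE, OF convex_real_interval(1)])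
       (use d \<open>0 \<le> t\<close> in auto)
  then show ?thesis by (simp add: truncated_initial)
qed

text \<open>Plain compactness. The bound serves the proof of nonnegativity, where conservation of
  mass cannot yet control single components.\<close>

lemma truncated_bounded:
  assumes "0 \<le> T"
  obtains B where "0 \<le> B" "\<And>i t. i \<le> N \<Longrightarrow> 0 \<le> t \<Longrightarrow> t \<le> T \<Longrightarrow> \<bar>u t i\<bar> \<le> B"
proof -
  have "continuous_on {0..T} (\<lambda>t. u t i)" if "i \<le> N" for i
  proof (rule continuous_on_subset)
    show "continuous_on {0..} (\<lambda>t. u t i)"
      using truncated_deriv[OF that]
      by (auto simp: continuous_on_eq_continuous_within intro: DERIV_continuous)
  qed auto
  then have "continuous_on {0..T} (\<lambda>t. \<Sum>i\<le>N. \<bar>u t i\<bar>)"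
    by (intro continuous_intros) auto
  then have "compact ((\<lambda>t. \<Sum>i\<le>N. \<bar>u t i\<bar>) ` {0..T})"
    by (rule compact_continuous_image) simp
  then obtain B where B: "\<And>t. 0 \<le> t \<Longrightarrow> t \<le> T \<Longrightarrow> \<bar>\<Sum>i\<le>N. \<bar>u t i\<bar>\<bar> \<le> B"
    using compact_imp_bounded by (fastforce simp: bounded_iff)
  show thesis
  proof
    show "0 \<le> B" using B[of 0] assms by linarith
    fix i t assume *: "i \<le> N" "0 \<le> t" "t \<le> T"
    have "\<bar>u t i\<bar> \<le> (\<Sum>i\<le>N. \<bar>u t i\<bar>)"
      using * by (intro member_le_sum) auto
    then show "\<bar>u t i\<bar> \<le> B" using B[of t] * by linarith
  qed
qed

end

section \<open>Nonnegativity of truncated solutions\<close>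

text \<open>The product is negative only if the signs differ; then its modulus is the negative part
  of one factor times at most \<open>B\<close>. Note that \<open>min x 0\<close> is minus the
  negative part.\<close>

lemma mult_ge_neg_parts:
  fixes x y B :: real
  assumes "\<bar>x\<bar> \<le> B" "\<bar>y\<bar> \<le> B"
  shows "- (x * y) \<le> - B * (min x 0 + min y 0)"
proof -
  have "B * min x 0 + B * min y 0 \<le> x * y"
  proof (cases "x \<ge> 0"; cases "y \<ge> 0")
    assume "x \<ge> 0" "\<not> y \<ge> 0"
    then show ?thesis using assms mult_right_mono_neg[of x B y] by simp
  next
    assume "\<not> x \<ge> 0" "y \<ge> 0"
    then show ?thesis using assms mult_right_mono_neg[of y B x] by (simp add: mult.commute)
  next
    assume "\<not> x \<ge> 0" "\<not> y \<ge> 0"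
    then have "0 \<le> x * y" "B * x \<le> 0" "B * y \<le> 0"
      using assms by (auto simp: mult_le_0_iff zero_le_mult_iff)
    with \<open>\<not> x \<ge> 0\<close> \<open>\<not> y \<ge> 0\<close> show ?thesis by simp
  qed simp
  then show ?thesis by (simp add: algebra_simps)
qed

text \<open>Testing the system with \<open>2 min(u\<^sub>i, 0)\<close> gives a Gronwall inequality for \<open>\<Sum> min(u\<^sub>i, 0)\<^sup>2\<close>.\<close>

lemma truncated_nonneg:
  assumes sol: "truncated_solution a N cin u"
    and a_nonneg: "\<And>p j k. 1 \<le> k \<Longrightarrow> k \<le> p \<Longrightarrow> 0 \<le> a p j k"
    and cin_nonneg: "\<And>i. 0 \<le> cin i"
    and "0 \<le> T" "i \<le> N"
  shows "0 \<le> u T i"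
proof -
  define V where "V t = (\<Sum>i\<le>N. (min (u t i) 0)\<^sup>2)" for t
  define V' where "V' t = (\<Sum>i\<le>N. (2 * min (u t i) 0) * QN a N i (u t))" for t
  obtain B where B: "0 \<le> B" "\<And>i t. i \<le> N \<Longrightarrow> 0 \<le> t \<Longrightarrow> t \<le> T \<Longrightarrow> \<bar>u t i\<bar> \<le> B"
    using truncated_bounded[OF sol \<open>0 \<le> T\<close>] by metis
  \<comment> \<open>Per exchange, two gain terms contribute at most \<open>2 * B * V t\<close> each
    and two loss terms at most \<open>B * V t\<close> each; the factor 2 from differentiating the
    square makes this 12.\<close>
  define K where "K = (\<Sum>(k, p, j)\<in>exchanges N. a p j k * (12 * B))"
  have V_deriv: "(V has_real_derivative V' t) (at t within {0..})" if "0 \<le> t" for t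
    unfolding V_def V'_def
    by (intro DERIV_sum DERIV_chain2[OF has_real_derivative_min_0_square] truncated_deriv[OF sol] that)
       auto
  have "V' t \<le> K * V t" if "0 < t" "t < T" for t
  proof -
    define w where "w i = - min (u t i) 0" for i
    have w_nonneg: "0 \<le> w i" for i by (simp add: w_def)
    have bd: "\<bar>u t i\<bar> \<le> B" if "i \<le> N" for i using B(2) that \<open>0 < t\<close> \<open>t < T\<close> by simp
    have ww: "w x * w y \<le> V t" if "x \<le> N" "y \<le> N" for x y
    proof -
      have sq: "(w x)\<^sup>2 \<le> V t" if "x \<le> N" for x
        unfolding V_def w_def power2_minus
        by (rule member_le_sum[of x "{..N}" "\<lambda>i. (min (u t i) 0)\<^sup>2"]) (use that in auto)
      have "2 * (w x * w y) \<le> (w x)\<^sup>2 + (w y)\<^sup>2"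
        using sum_squares_bound[of "w x" "w y"] by (simp add: mult.assoc)
      with sq[OF that(1)] sq[OF that(2)] show ?thesis by linarith
    qed
    have V_nonneg: "0 \<le> V t" by (simp add: V_def sum_nonneg)
    \<comment> \<open>A loss term contains the tested component itself, so the square of its
      negative part splits off at once.\<close>
    have loss: "u t x * u t y * w x \<le> B * V t" if "x \<le> N" "y \<le> N" for x y
    proof -
      have "u t x * w x = - (w x * w x)" by (auto simp: w_def min_def)
      then have "u t x * u t y * w x = (w x * w x) * (- u t y)"
        by (metis mult.commute mult.assoc minus_mult_commute)
      also have "\<dots> \<le> (w x * w x) * B"
        using bd[OF that(2)] w_nonneg[of x] by (intro mult_left_mono) auto
      also have "\<dots> \<le> V t * B"
        using ww[OF that(1) that(1)] B(1) by (rule mult_right_mono)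
      finally show ?thesis by (simp add: mult.commute)
    qed
    \<comment> \<open>Here the tested component is in general neither factor of the rate. A negative
      part must come from the product \<open>u t x * u t y\<close>, to be paired with
      \<open>w z\<close>.\<close>
    have gain: "- (u t x * u t y) * w z \<le> 2 * (B * V t)" if "x \<le> N" "y \<le> N" "z \<le> N" for x y z
    proof -
      have "- (u t x * u t y) * w z \<le> B * (w x + w y) * w z"
        using mult_ge_neg_parts[OF bd[OF that(1)] bd[OF that(2)]] w_nonneg[of z]
        by (intro mult_right_mono) (auto simp: w_def algebra_simps)
      also have "\<dots> = B * (w x * w z + w y * w z)" by (simp add: algebra_simps)
      also have "\<dots> \<le> B * (V t + V t)"
        using B(1) ww that by (intro mult_left_mono add_mono) auto
      finally show ?thesis by simp
    qed
    have "V' t = (\<Sum>(k, p, j)\<in>exchanges N. a p j k * u t p * u t j *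
        (2 * min (u t (p - k)) 0 + 2 * min (u t (j + k)) 0 - 2 * min (u t p) 0 - 2 * min (u t j) 0))"
      unfolding V'_def by (rule QN_weak)
    also have "\<dots> \<le> (\<Sum>(k, p, j)\<in>exchanges N. a p j k * (12 * B) * V t)"
    proof (rule sum_mono, clarify)
      fix k p j assume "(k, p, j) \<in> exchanges N"
      then have kpj: "1 \<le> k" "k \<le> p" "p \<le> N" "j \<le> N" "p - k \<le> N" "j + k \<le> N"
        by (auto simp: mem_exchanges)
      have "u t p * u t j * (2 * min (u t (p - k)) 0 + 2 * min (u t (j + k)) 0
              - 2 * min (u t p) 0 - 2 * min (u t j) 0)
          = 2 * (- (u t p * u t j) * w (p - k)) + 2 * (- (u t p * u t j) * w (j + k))
            + 2 * (u t p * u t j * w p) + 2 * (u t j * u t p * w j)"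
        by (simp add: w_def algebra_simps)
      also have "\<dots> \<le> 12 * B * V t"
        using loss[of p j] loss[of j p] gain[of p j "p - k"] gain[of p j "j + k"] kpj by linarith
      finally show "a p j k * u t p * u t j * (2 * min (u t (p - k)) 0 + 2 * min (u t (j + k)) 0
              - 2 * min (u t p) 0 - 2 * min (u t j) 0) \<le> a p j k * (12 * B) * V t"
        using mult_left_mono[OF _ a_nonneg[OF kpj(1,2)]] by (simp add: mult.assoc)
    qed
    also have "\<dots> = K * V t"
      by (simp add: K_def sum_distrib_right case_prod_unfold)
    finally show ?thesis .
  qed
  from gronwall_nonneg_time[OF V_deriv this \<open>0 \<le> T\<close>] have "V T \<le> V 0 * exp (K * T)" .
  moreover have "V 0 = 0"
    using cin_nonneg by (simp add: V_def truncated_initial[OF sol])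
  ultimately have "(\<Sum>i\<le>N. (min (u T i) 0)\<^sup>2) \<le> 0" by (simp add: V_def)
  moreover have "(min (u T i) 0)\<^sup>2 \<le> (\<Sum>i\<le>N. (min (u T i) 0)\<^sup>2)"
    by (rule member_le_sum) (use \<open>i \<le> N\<close> in auto)
  ultimately have "(min (u T i) 0)\<^sup>2 \<le> 0" by linarith
  then show ?thesis by simp
qed

section \<open>The tail weight\<close>

text \<open>Kept as \<open>x\<close> times the increasing ratio \<open>x / (x + n)\<close>, since
  the ratio is also used alone. The weight behaves like the square of \<open>x\<close> over
  \<open>n\<close> well below \<open>n\<close> and like \<open>x\<close> well above.\<close>

definition tail_weight :: "real \<Rightarrow> real \<Rightarrow> real" where
  "tail_weight n x = x * (x / (x + n))"

lemma tail_weight_0 [simp]: "tail_weight n 0 = 0"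
  by (simp add: tail_weight_def)

context
  fixes n :: real
  assumes n_pos: "0 < n"
begin

lemma tail_ratio_mono: "0 \<le> x \<Longrightarrow> x \<le> y \<Longrightarrow> x / (x + n) \<le> y / (y + n)"
  using n_pos by (simp add: frac_le_eq divide_le_0_iff algebra_simps mult_left_mono)

lemma tail_weight_nonneg: "0 \<le> x \<Longrightarrow> 0 \<le> tail_weight n x"
  using n_pos by (simp add: tail_weight_def)

lemma tail_weight_le: "0 \<le> x \<Longrightarrow> tail_weight n x \<le> x"
  unfolding tail_weight_def using n_pos by (intro mult_left_le) auto

text \<open>The ratio equals 1/2 at \<open>x = n\<close> and increases.\<close>

lemma tail_weight_ge: "n \<le> x \<Longrightarrow> x / 2 \<le> tail_weight n x"
  using mult_left_mono[OF tail_ratio_mono[of n x], of x] n_pos by (simp add: tail_weight_def)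

lemma tail_weight_le_ratio:
  assumes "0 \<le> x" "x \<le> L"
  shows "tail_weight n x \<le> L / n * x"
proof -
  have "x / (x + n) \<le> L / n"
    using assms n_pos by (intro frac_le) auto
  then show ?thesis
    using assms mult_right_mono[of "x / (x + n)" "L / n" x] by (simp add: tail_weight_def mult.commute)
qed

lemma tail_weight_scale:
  assumes "0 \<le> x" "x \<le> y"
  shows "tail_weight n x \<le> x * (y / (y + n))"
  unfolding tail_weight_def using assms by (intro mult_left_mono tail_ratio_mono)

text \<open>Replacing both ratios by the larger one at \<open>x + y\<close> only increases the left
  side, and the result is exactly the right side.\<close>

lemma tail_weight_superadditive:
  assumes "0 \<le> x" "0 \<le> y"
  shows "tail_weight n x + tail_weight n y \<le> tail_weight n (x + y)"
  using tail_weight_scale[of x "x + y"] tail_weight_scale[of y "x + y"] assms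
  by (simp add: tail_weight_def distrib_right add_divide_distrib)

text \<open>With \<open>s = x + y\<close>, both sides have the factor
  \<open>x * y / ((x + n) * (y + n))\<close>. What remains is
  \<open>n * s * (s + 2 * n) / (s + n)\<close> against \<open>2 * (2 * x * y + n * s)\<close>, and
  \<open>(s + 2 * n) / (s + n)\<close> is at most 2.\<close>

lemma tail_weight_defect:
  assumes "0 \<le> x" "0 \<le> y"
  shows "(x + y) * (tail_weight n (x + y) - tail_weight n x - tail_weight n y)
           \<le> 2 * (x * tail_weight n y + y * tail_weight n x)"
proof -
  define s where "s = x + y"
  have pos: "0 < x + n" "0 < y + n" "0 < s + n" "0 \<le> s" "0 \<le> x * y" using assms n_pos by (auto simp: s_def)
  have inc: "s / (s + n) - z / (z + n) = (s - z) * n / ((s + n) * (z + n))"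
    if "0 < z + n" for z using that pos by (simp add: field_simps)
  have "tail_weight n s - tail_weight n x - tail_weight n y
      = x * (s / (s + n) - x / (x + n)) + y * (s / (s + n) - y / (y + n))"
    by (simp add: tail_weight_def s_def algebra_simps add_divide_distrib)
  also have "\<dots> = x * y * n / (s + n) * (1 / (x + n) + 1 / (y + n))"
    unfolding inc[OF pos(1)] inc[OF pos(2)] by (simp add: s_def divide_simps) (simp add: algebra_simps)
  also have "1 / (x + n) + 1 / (y + n) = (s + 2 * n) / ((x + n) * (y + n))"
    using pos by (simp add: s_def field_simps)
  finally have eq: "tail_weight n s - tail_weight n x - tail_weight n y
      = x * y * n / (s + n) * ((s + 2 * n) / ((x + n) * (y + n)))" .
  have "s * (tail_weight n s - tail_weight n x - tail_weight n y)
      = (x * y / ((x + n) * (y + n))) * (n * s * ((s + 2 * n) / (s + n)))"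
    unfolding eq by (simp only: times_divide_eq_right times_divide_eq_left divide_divide_eq_left mult_ac)
  also have "\<dots> \<le> (x * y / ((x + n) * (y + n))) * (2 * (2 * (x * y) + n * s))"
  proof (rule mult_left_mono)
    have "(s + 2 * n) / (s + n) \<le> 2" using pos by (simp add: field_simps)
    then have "n * s * ((s + 2 * n) / (s + n)) \<le> n * s * 2"
      using n_pos pos by (intro mult_left_mono) auto
    with pos show "n * s * ((s + 2 * n) / (s + n)) \<le> 2 * (2 * (x * y) + n * s)" by simp
  qed (use pos in simp)
  also have "\<dots> = 2 * (x * tail_weight n y + y * tail_weight n x)"
    using pos by (simp add: tail_weight_def s_def divide_simps) (simp add: algebra_simps)
  finally show ?thesis by (simp add: s_def)
qed

end

section \<open>Uniform tail estimate\<close>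

text \<open>Gronwall for the weighted moment. The defect estimate absorbs the factor
  \<open>j + k\<close> of the rate, and summing over \<open>k\<close> uses the bound on
  \<open>q\<close>. The exponent is independent of \<open>n\<close> and sees the truncation only
  through the initial mass.\<close>

lemma truncated_tail_moment:
  assumes sol: "truncated_solution a N cin u"
    and a_nonneg: "\<And>p j k. 1 \<le> k \<Longrightarrow> k \<le> p \<Longrightarrow> 0 \<le> a p j k"
    and cin_nonneg: "\<And>i. 0 \<le> cin i"
    and "0 \<le> C"
    and q_sum: "\<And>i. 1 \<le> i \<Longrightarrow> (\<Sum>k=1..i. real k * (real i - real k + 1) * q i k) \<le> Q * real i"
    and a_le: "\<And>i j k. 1 \<le> k \<Longrightarrow> k \<le> i \<Longrightarrow> 1 \<le> j \<Longrightarrow>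
           a i j k \<le> C * (real i - real k + 1) * (real j + real k) * q i k"
    and q_nonneg: "\<And>i k. 1 \<le> k \<Longrightarrow> k \<le> i \<Longrightarrow> 0 \<le> q i k"
    and n: "0 < n" and T: "0 \<le> T"
  shows "(\<Sum>i\<le>N. tail_weight n i * u T i)
           \<le> (\<Sum>i\<le>N. tail_weight n i * cin i) * exp (4 * C * Q * (\<Sum>i\<le>N. real i * cin i) * T)"
proof -
  define g where "g i = tail_weight n (real i)" for i :: nat
  define r where "r i = real i / (real i + n)" for i :: nat
  define M where "M = (\<Sum>i\<le>N. real i * cin i)"
  have g_eq: "g i = real i * r i" for i by (simp add: g_def r_def tail_weight_def)
  have g_nonneg: "0 \<le> g i" for i using n by (simp add: g_def tail_weight_nonneg)
  have r_nonneg: "0 \<le> r i" for i using n by (simp add: r_def)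
  have u_nonneg: "0 \<le> u t i" if "0 \<le> t" "i \<le> N" for t i
    using truncated_nonneg[OF sol a_nonneg cin_nonneg that] .
  have "(\<Sum>i\<le>N. g i * QN a N i (u t)) \<le> 4 * C * Q * M * (\<Sum>i\<le>N. g i * u t i)" if t: "0 < t" for t
  proof -
    \<comment> \<open>Majorant of one exchange. A factor \<open>real k\<close> is pulled out, so
      that summing over \<open>k\<close> produces the left side of \<open>q_sum\<close>.\<close>
    define D where "D p k j = C * (real p - real k + 1) * q p k * 2 * (real k * (real j * r p + g j))"
      for p k j
    have kernel: "a p j k * (g (p - k) + g (j + k) - g p - g j) \<le> D p k j"
      if kp: "1 \<le> k" "k \<le> p" for p j k
    proof -
      have D_nonneg: "0 \<le> D p k j"
        using \<open>0 \<le> C\<close> q_nonneg[OF kp] g_nonneg[of j] r_nonneg[of p] kp by (simp add: D_def)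
      have split: "g (p - k) + g k \<le> g p"
        using tail_weight_superadditive[OF n, of "real (p - k)" "real k"] kp
        by (simp add: g_def of_nat_diff)
      show ?thesis
      proof (cases "j = 0")
        \<comment> \<open>The growth bound says nothing about transfers to empty clusters; there the
          bracket is nonpositive by superadditivity.\<close>
        case True
        then have "g (p - k) + g (j + k) - g p - g j \<le> 0" using split by (simp add: g_def)
        then have "a p j k * (g (p - k) + g (j + k) - g p - g j) \<le> 0"
          using a_nonneg[OF kp] by (simp add: mult_nonneg_nonpos)
        with D_nonneg show ?thesis by linarith
      next
        case False
        have def_nonneg: "0 \<le> g (j + k) - g j - g k"
          using tail_weight_superadditive[OF n, of "real j" "real k"] by (simp add: g_def)
        have gk: "g k \<le> real k * r p"
          using tail_weight_scale[OF n, of "real k" "real p"] kp by (simp add: g_def r_def)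
        \<comment> \<open>Superadditivity at the donor replaces \<open>g (p - k) - g p\<close> by
          \<open>- g k\<close>, leaving the defect at the receiver.\<close>
        have "a p j k * (g (p - k) + g (j + k) - g p - g j) \<le> a p j k * (g (j + k) - g j - g k)"
          using split a_nonneg[OF kp] by (intro mult_left_mono) auto
        also have "\<dots> \<le> C * (real p - real k + 1) * (real j + real k) * q p k * (g (j + k) - g j - g k)"
          using False a_le[OF kp, of j] def_nonneg by (intro mult_right_mono) auto
        also have "\<dots> = C * (real p - real k + 1) * q p k * ((real j + real k) * (g (j + k) - g j - g k))"
          by (simp add: mult_ac)
        also have "\<dots> \<le> C * (real p - real k + 1) * q p k * (2 * (real j * g k + real k * g j))"
          using tail_weight_defect[OF n, of "real j" "real k"] \<open>0 \<le> C\<close> q_nonneg[OF kp] kp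
          by (intro mult_left_mono) (auto simp: g_def)
        also have "\<dots> \<le> C * (real p - real k + 1) * q p k * (2 * (real j * (real k * r p) + real k * g j))"
          using gk \<open>0 \<le> C\<close> q_nonneg[OF kp] kp by (intro mult_left_mono add_mono order_refl) auto
        also have "\<dots> = D p k j" by (simp add: D_def algebra_simps)
        finally show ?thesis .
      qed
    qed
    have D_nonneg: "0 \<le> D p k j" if "1 \<le> k" "k \<le> p" for p k j
      using \<open>0 \<le> C\<close> q_nonneg[OF that] g_nonneg[of j] r_nonneg[of p] that by (simp add: D_def)
    have D_sum: "(\<Sum>k=1..p. D p k j) \<le> 2 * C * Q * (real j * g p + real p * g j)" if "1 \<le> p" for p j
    proof -
      have "(\<Sum>k=1..p. D p k j)
          = (\<Sum>k=1..p. real k * (real p - real k + 1) * q p k) * (2 * C * (real j * r p + g j))"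
        unfolding sum_distrib_right by (intro sum.cong) (auto simp: D_def mult_ac)
      also have "\<dots> \<le> Q * real p * (2 * C * (real j * r p + g j))"
        using q_sum[OF that] \<open>0 \<le> C\<close> g_nonneg[of j] r_nonneg[of p] by (intro mult_right_mono) auto
      finally show ?thesis by (simp add: g_eq algebra_simps)
    qed
    have mass: "(\<Sum>i\<le>N. real i * u t i) = M"
      unfolding M_def by (rule truncated_conserves[OF sol]) (use t in auto)
    have "(\<Sum>i\<le>N. g i * QN a N i (u t)) =
        (\<Sum>(k, p, j)\<in>exchanges N. a p j k * (g (p - k) + g (j + k) - g p - g j) * (u t p * u t j))"
      unfolding QN_weak by (intro sum.cong) auto
    also have "\<dots> \<le> (\<Sum>(k, p, j)\<in>exchanges N. D p k j * (u t p * u t j))"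
      using t by (intro sum_mono) (auto simp: mem_exchanges intro!: mult_right_mono kernel mult_nonneg_nonneg u_nonneg)
    also have "\<dots> = (\<Sum>(p, j, k)\<in>(\<lambda>(k, p, j). (p, j, k)) ` exchanges N. D p k j * (u t p * u t j))"
      by (subst sum.reindex) (auto simp: inj_on_def case_prod_unfold)
    \<comment> \<open>Dropping the constraint \<open>j + k \<le> N\<close> adds nonnegative terms
      and lets \<open>k\<close> run over all of \<open>{1..p}\<close>.\<close>
    also have "\<dots> \<le> (\<Sum>(p, j, k)\<in>(SIGMA p:{1..N}. SIGMA j:{..N}. {1..p}). D p k j * (u t p * u t j))"
      using t by (intro sum_mono2) (auto simp: mem_exchanges intro!: mult_nonneg_nonneg D_nonneg u_nonneg)
    also have "\<dots> = (\<Sum>p=1..N. \<Sum>j\<le>N. (\<Sum>k=1..p. D p k j) * (u t p * u t j))"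
      by (simp add: sum.Sigma sum_distrib_right)
    also have "\<dots> \<le> (\<Sum>p=1..N. \<Sum>j\<le>N. 2 * C * Q * (real j * g p + real p * g j) * (u t p * u t j))"
      using t by (intro sum_mono mult_right_mono D_sum mult_nonneg_nonneg u_nonneg) auto
    \<comment> \<open>The added term \<open>p = 0\<close> vanishes because
      \<open>g 0 = 0\<close>.\<close>
    also have "\<dots> = (\<Sum>p\<le>N. \<Sum>j\<le>N. 2 * C * Q * (real j * g p + real p * g j) * (u t p * u t j))"
      by (rule sum.mono_neutral_left) (auto simp: g_def not_le)
    also have "\<dots> = 2 * C * Q * ((\<Sum>p\<le>N. g p * u t p) * (\<Sum>j\<le>N. real j * u t j)
        + (\<Sum>p\<le>N. real p * u t p) * (\<Sum>j\<le>N. g j * u t j))"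
      unfolding sum_product sum.distrib[symmetric] unfolding sum_distrib_left
      by (intro sum.cong refl) (simp add: algebra_simps)
    also have "\<dots> = 4 * C * Q * M * (\<Sum>i\<le>N. g i * u t i)"
      by (simp add: mass)
    finally show ?thesis .
  qed
  from gronwall_nonneg_time[OF truncated_moment_deriv[OF sol] this T]
  show ?thesis by (simp add: g_def M_def truncated_initial[OF sol])
qed

text \<open>Split at an index \<open>L\<close>: from \<open>L\<close> on the weight is at most
  \<open>i\<close> and the tail of the first moment is small; below \<open>L\<close> it is at most
  \<open>L / n * i\<close>, small for large \<open>n\<close>.\<close>

lemma tail_weight_initial_small:
  fixes cin :: "nat \<Rightarrow> real"
  assumes cin_nonneg: "\<And>i. 0 \<le> cin i" and summ: "summable (\<lambda>i. real i * cin i)" and "0 < \<epsilon>"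
  obtains n where "0 < n" "\<And>N. (\<Sum>i\<le>N. tail_weight n i * cin i) \<le> \<epsilon>"
proof -
  let ?f = "\<lambda>i. real i * cin i"
  define M where "M = suminf ?f"
  have M_nonneg: "0 \<le> M" unfolding M_def using summ cin_nonneg by (intro suminf_nonneg) auto
  obtain L where L: "\<And>m. norm (sum ?f {L..<m}) < \<epsilon> / 2"
    using summ \<open>0 < \<epsilon>\<close> unfolding summable_Cauchy by (meson half_gt_zero le_refl)
  \<comment> \<open>Chosen so that \<open>L * M / n \<le> \<epsilon> / 2\<close>; the summand 1
    keeps \<open>n\<close> positive if \<open>L\<close> or \<open>M\<close> is zero.\<close>
  define n where "n = real L * (2 * M / \<epsilon>) + 1"
  have n: "0 < n" using M_nonneg \<open>0 < \<epsilon>\<close> by (simp add: n_def add_nonneg_pos)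
  show thesis
  proof
    show "0 < n" by (rule n)
    fix N :: nat
    have "(\<Sum>i\<le>N. tail_weight n i * cin i)
        \<le> (\<Sum>i\<le>N. real L / n * ?f i + (if L \<le> i then ?f i else 0))"
    proof (rule sum_mono)
      fix i
      show "tail_weight n i * cin i \<le> real L / n * ?f i + (if L \<le> i then ?f i else 0)"
      proof (cases "L \<le> i")
        case True
        have "tail_weight n i * cin i \<le> ?f i"
          using tail_weight_le[OF n] cin_nonneg by (intro mult_right_mono) auto
        moreover have "0 \<le> real L / n * ?f i" using n cin_nonneg by simp
        ultimately show ?thesis using True by simp
      next
        case False
        then show ?thesis
          using mult_right_mono[OF tail_weight_le_ratio[OF n, of "real i" "real L"] cin_nonneg[of i]]
          by (simp add: mult.assoc)
      qed
    qed
    also have "\<dots> = real L / n * (\<Sum>i\<le>N. ?f i) + (\<Sum>i\<le>N. if L \<le> i then ?f i else 0)"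
      by (simp add: sum.distrib sum_distrib_left)
    also have "(\<Sum>i\<le>N. if L \<le> i then ?f i else 0) = sum ?f {L..<Suc N}"
      by (rule sum.mono_neutral_cong_right) auto
    also have "real L / n * (\<Sum>i\<le>N. ?f i) \<le> real L / n * M"
      using n summ cin_nonneg unfolding M_def by (intro mult_left_mono sum_le_suminf) auto
    also have "real L / n * M \<le> \<epsilon> / 2"
    proof -
      have "\<epsilon> * n = 2 * (real L * M) + \<epsilon>"
        using \<open>0 < \<epsilon>\<close> by (simp add: n_def distrib_left)
      with \<open>0 < \<epsilon>\<close> have "2 * (real L * M) \<le> \<epsilon> * n" by linarith
      with n show ?thesis by (simp add: pos_divide_le_eq)
    qed
    also have "sum ?f {L..<Suc N} \<le> \<epsilon> / 2"
      using L[of "Suc N"] by simp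
    finally show "(\<Sum>i\<le>N. tail_weight n i * cin i) \<le> \<epsilon>" by simp
  qed
qed

text \<open>The initial weighted moment is made small enough to survive the Gronwall factor up to
  time \<open>T\<close>. The cutoff depends on \<open>T\<close> and \<open>\<epsilon>\<close>, not
  on the truncation.\<close>

lemma truncated_tail_uniform:
  assumes a_nonneg: "\<And>p j k. 1 \<le> k \<Longrightarrow> k \<le> p \<Longrightarrow> 0 \<le> a p j k"
    and cin_nonneg: "\<And>i. 0 \<le> cin i" and summ: "summable (\<lambda>i. real i * cin i)"
    and "0 \<le> C" "0 \<le> Q"
    and q_sum: "\<And>i. 1 \<le> i \<Longrightarrow> (\<Sum>k=1..i. real k * (real i - real k + 1) * q i k) \<le> Q * real i"
    and a_le: "\<And>i j k. 1 \<le> k \<Longrightarrow> k \<le> i \<Longrightarrow> 1 \<le> j \<Longrightarrow>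
           a i j k \<le> C * (real i - real k + 1) * (real j + real k) * q i k"
    and q_nonneg: "\<And>i k. 1 \<le> k \<Longrightarrow> k \<le> i \<Longrightarrow> 0 \<le> q i k"
    and T: "0 \<le> T" and "0 < \<epsilon>"
  shows "\<exists>n\<ge>1. \<forall>N u. truncated_solution a N cin u \<longrightarrow> (\<Sum>i\<in>{n..N}. real i * u T i) \<le> \<epsilon>"
proof -
  define M where "M = (\<Sum>i. real i * cin i)"
  define E where "E = exp (4 * C * Q * M * T)"
  \<comment> \<open>\<open>E\<close> dominates the Gronwall factor of every truncation, since
    partial first moments are at most \<open>M\<close>. The 2 pays for
    \<open>x / 2 \<le> tail_weight n x\<close>.\<close>
  have "0 < \<epsilon> / (2 * E)" using \<open>0 < \<epsilon>\<close> by (simp add: E_def)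
  from tail_weight_initial_small[OF cin_nonneg summ this]
  obtain n where n: "0 < n" "\<And>N. (\<Sum>i\<le>N. tail_weight n i * cin i) \<le> \<epsilon> / (2 * E)" by metis
  obtain n' :: nat where n': "n \<le> real n'" using real_arch_simple by blast
  show ?thesis
  proof (intro exI conjI allI impI)
    show "1 \<le> n'" using n' n(1) by (cases n') auto
    fix N u assume sol: "truncated_solution a N cin u"
    have u_nonneg: "0 \<le> u T i" if "i \<le> N" for i
      using truncated_nonneg[OF sol a_nonneg cin_nonneg T that] .
    have "(\<Sum>i\<in>{n'..N}. real i * u T i) \<le> (\<Sum>i\<in>{n'..N}. 2 * (tail_weight n i * u T i))"
    proof (rule sum_mono)
      fix i assume i: "i \<in> {n'..N}"
      then have "real i / 2 \<le> tail_weight n i" using n' n(1) by (intro tail_weight_ge) auto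
      then show "real i * u T i \<le> 2 * (tail_weight n i * u T i)"
        using mult_right_mono[of "real i / 2" "tail_weight n i" "u T i"] u_nonneg i by auto
    qed
    also have "\<dots> \<le> (\<Sum>i\<le>N. 2 * (tail_weight n i * u T i))"
      using n(1) u_nonneg by (intro sum_mono2) (auto simp: tail_weight_nonneg)
    also have "\<dots> = 2 * (\<Sum>i\<le>N. tail_weight n i * u T i)" by (simp add: sum_distrib_left)
    also have "\<dots> \<le> 2 * ((\<Sum>i\<le>N. tail_weight n i * cin i)
        * exp (4 * C * Q * (\<Sum>i\<le>N. real i * cin i) * T))"
      using truncated_tail_moment[OF sol a_nonneg cin_nonneg \<open>0 \<le> C\<close> q_sum a_le q_nonneg n(1) T]
      by simp
    also have "\<dots> \<le> 2 * (\<epsilon> / (2 * E) * E)"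
    proof (intro mult_left_mono mult_mono n(2))
      have "(\<Sum>i\<le>N. real i * cin i) \<le> M"
        unfolding M_def using summ cin_nonneg by (intro sum_le_suminf) auto
      then show "exp (4 * C * Q * (\<Sum>i\<le>N. real i * cin i) * T) \<le> E"
        using \<open>0 \<le> C\<close> \<open>0 \<le> Q\<close> T unfolding E_def
        by (simp add: mult_right_mono mult_left_mono)
    qed (use \<open>0 < \<epsilon>\<close> in \<open>auto simp: E_def\<close>)
    also have "\<dots> = \<epsilon>" by (simp add: E_def)
    finally show "(\<Sum>i\<in>{n'..N}. real i * u T i) \<le> \<epsilon>" .
  qed
qed

section \<open>Passage to the limit\<close>

text \<open>Nonnegativity bounds the partial sums of the limit by \<open>A\<close>, as in Fatou's
  lemma; uniformly small tails prevent loss of mass at infinity. Entries \<open>v m i\<close> beyond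
  \<open>N m\<close> are arbitrary, so every sum stops at \<open>N m\<close>.\<close>

lemma sums_limit_of_truncations:
  fixes f :: "nat \<Rightarrow> real" and v :: "nat \<Rightarrow> nat \<Rightarrow> real" and N :: "nat \<Rightarrow> nat"
  assumes N: "strict_mono N"
    and lim: "\<And>i. (\<lambda>m. v m i) \<longlonglongrightarrow> f i"
    and v_nonneg: "\<And>m i. i \<le> N m \<Longrightarrow> 0 \<le> v m i"
    and total: "(\<lambda>m. \<Sum>i\<le>N m. v m i) \<longlonglongrightarrow> A"
    and tail: "\<And>\<epsilon>. 0 < \<epsilon> \<Longrightarrow> \<exists>n. \<forall>m. (\<Sum>i\<in>{n..N m}. v m i) \<le> \<epsilon>"
  shows "f sums A"
proof -
  have ev: "\<forall>\<^sub>F m in sequentially. n \<le> N m" for n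
    using filterlim_subseq[OF N] by (simp add: filterlim_at_top)
  have plim: "(\<lambda>m. \<Sum>i<n. v m i) \<longlonglongrightarrow> (\<Sum>i<n. f i)" for n
    by (intro tendsto_sum lim)
  \<comment> \<open>For fixed \<open>i\<close> the sign of \<open>v m i\<close> is known only once
    \<open>i \<le> N m\<close>, hence eventually.\<close>
  have f_nonneg: "0 \<le> f i" for i
    by (rule tendsto_lowerbound[OF lim])
       (use ev[of i] in \<open>auto elim!: eventually_mono intro: v_nonneg\<close>)
  have upper: "(\<Sum>i<n. f i) \<le> A" for n
  proof (rule tendsto_le[OF _ total plim])
    show "\<forall>\<^sub>F m in sequentially. (\<Sum>i<n. v m i) \<le> (\<Sum>i\<le>N m. v m i)"
      using ev[of n] by eventually_elim (auto intro!: sum_mono2 v_nonneg)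
  qed simp
  have lower: "\<exists>n. A - \<epsilon> \<le> (\<Sum>i<n. f i)" if "0 < \<epsilon>" for \<epsilon>
  proof -
    obtain n where n: "\<And>m. (\<Sum>i\<in>{n..N m}. v m i) \<le> \<epsilon>" using tail[OF \<open>0 < \<epsilon>\<close>] by blast
    have "A - \<epsilon> \<le> (\<Sum>i<n. f i)"
    proof (rule tendsto_le[OF _ plim tendsto_diff[OF total tendsto_const]])
      show "\<forall>\<^sub>F m in sequentially. (\<Sum>i\<le>N m. v m i) - \<epsilon> \<le> (\<Sum>i<n. v m i)"
        using ev[of n]
      proof eventually_elim
        case (elim m)
        have "{..N m} = {..<n} \<union> {n..N m}" using elim by auto
        then have "(\<Sum>i\<le>N m. v m i) = (\<Sum>i<n. v m i) + (\<Sum>i\<in>{n..N m}. v m i)"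
          by (simp add: sum.union_disjoint disjoint_iff)
        with n[of m] show ?case by linarith
      qed
    qed simp
    then show ?thesis by blast
  qed
  show ?thesis
    unfolding sums_def
  proof (rule LIMSEQ_I)
    fix \<epsilon> :: real assume "0 < \<epsilon>"
    then obtain n where n: "A - \<epsilon> / 2 \<le> (\<Sum>i<n. f i)" using lower[of "\<epsilon> / 2"] by auto
    have "norm ((\<Sum>i<m. f i) - A) < \<epsilon>" if "n \<le> m" for m
    proof -
      have "(\<Sum>i<n. f i) \<le> (\<Sum>i<m. f i)" using that f_nonneg by (intro sum_mono2) auto
      with n upper[of m] \<open>0 < \<epsilon>\<close> show ?thesis by (simp add: abs_if)
    qed
    then show "\<exists>no. \<forall>m\<ge>no. norm ((\<Sum>i<m. f i) - A) < \<epsilon>" by blast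
  qed
qed

theorem theorem3p3:
  fixes a :: "nat \<Rightarrow> nat \<Rightarrow> nat \<Rightarrow> real"
    and q :: "nat \<Rightarrow> nat \<Rightarrow> real"
    and C Q :: real
    and cin :: "nat \<Rightarrow> real"
    and c :: "real \<Rightarrow> nat \<Rightarrow> real"
  assumes "rate_coefficients a"
    and "1 \<le> C" and "1 \<le> Q"
    and "\<And>i k. 1 \<le> k \<Longrightarrow> k \<le> i \<Longrightarrow> 0 \<le> q i k"
    and "\<And>i. 1 \<le> i \<Longrightarrow> (\<Sum>k=1..i. real k * (real i - real k + 1) * q i k) \<le> Q * real i"
    and "\<And>i j k. 1 \<le> k \<Longrightarrow> k \<le> i \<Longrightarrow> 1 \<le> j \<Longrightarrow>
           a i j k \<le> C * (real i - real k + 1) * (real j + real k) * q i k"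
    and "cin \<in> X01_plus"
    and "admissible_solution a cin c"
  shows "\<forall>t\<ge>0. (\<Sum>i. c t i) = (\<Sum>i. cin i) \<and>
                (\<Sum>i. real i * c t i) = (\<Sum>i. real i * cin i)"
proof (intro allI impI)
  fix t :: real assume t: "0 \<le> t"
  have a_nonneg: "0 \<le> a p j k" if "1 \<le> k" "k \<le> p" for p j k
    using assms(1) that by (auto simp: rate_coefficients_def)
  have cin_nonneg: "0 \<le> cin i" for i using assms(7) by (simp add: X01_plus_def)
  have summ: "summable (\<lambda>i. (1 + real i) * cin i)"
    using assms(7) cin_nonneg by (simp add: X01_plus_def X01_def)
  have summ1: "summable (\<lambda>i. real i * cin i)"
    by (rule summable_comparison_test'[OF summ, of 0]) (auto simp: cin_nonneg intro: mult_right_mono)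
  have summ0: "summable cin"
    by (rule summable_comparison_test'[OF summ, of 0])
       (auto simp: cin_nonneg distrib_right)
  obtain N u where N: "strict_mono N"
    and sol: "\<And>m. truncated_solution a (N m) cin (u m)"
    and lim: "\<And>i. (\<lambda>m. u m t i) \<longlonglongrightarrow> c t i"
    using assms(8) t unfolding admissible_solution_def by blast
  have tail: "\<exists>n\<ge>1. \<forall>m. (\<Sum>i\<in>{n..N m}. real i * u m t i) \<le> \<epsilon>" if "0 < \<epsilon>" for \<epsilon>
  proof -
    have CQ: "0 \<le> C" "0 \<le> Q" using assms(2,3) by auto
    show ?thesis
      using truncated_tail_uniform[OF a_nonneg cin_nonneg summ1 CQ assms(5,6,4) t \<open>0 < \<epsilon>\<close>] sol
      by blast
  qed
  have u_nonneg: "0 \<le> u m t i" if "i \<le> N m" for m i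
    using truncated_nonneg[OF sol a_nonneg cin_nonneg t that] .
  \<comment> \<open>Treats both moments at once. The comparison \<open>g i \<le> real i\<close>
    starts at \<open>i = 1\<close> because the constant weight violates it at \<open>0\<close>;
    accordingly the tails start at some \<open>n \<ge> 1\<close>.\<close>
  have moment: "(\<lambda>i. g i * c t i) sums (\<Sum>i. g i * cin i)"
    if g: "\<And>i. 0 \<le> g i" "\<And>i. 1 \<le> i \<Longrightarrow> g i \<le> real i" "summable (\<lambda>i. g i * cin i)"
      and balance: "\<And>k p j. 1 \<le> k \<Longrightarrow> k \<le> p \<Longrightarrow> g (p - k) + g (j + k) = g p + g j"
    for g :: "nat \<Rightarrow> real"
  proof (rule sums_limit_of_truncations[OF N])
    show "(\<lambda>m. g i * u m t i) \<longlonglongrightarrow> g i * c t i" for i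
      by (intro tendsto_mult_left lim)
    show "0 \<le> g i * u m t i" if "i \<le> N m" for m i
      using g(1) u_nonneg[OF that] by simp
    have "(\<lambda>m. \<Sum>i\<le>N m. g i * cin i) \<longlonglongrightarrow> (\<Sum>i. g i * cin i)"
      using LIMSEQ_subseq_LIMSEQ[OF summable_LIMSEQ'[OF g(3)] N] by (simp add: o_def)
    then show "(\<lambda>m. \<Sum>i\<le>N m. g i * u m t i) \<longlonglongrightarrow> (\<Sum>i. g i * cin i)"
      using truncated_conserves[OF sol balance t] by simp
    fix \<epsilon> :: real assume "0 < \<epsilon>"
    then obtain n where n: "1 \<le> n" "\<And>m. (\<Sum>i\<in>{n..N m}. real i * u m t i) \<le> \<epsilon>"
      using tail by blast
    have "(\<Sum>i\<in>{n..N m}. g i * u m t i) \<le> (\<Sum>i\<in>{n..N m}. real i * u m t i)" for m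
      using n(1) by (intro sum_mono mult_right_mono g u_nonneg) auto
    with n(2) show "\<exists>n. \<forall>m. (\<Sum>i\<in>{n..N m}. g i * u m t i) \<le> \<epsilon>"
      by (meson order_trans)
  qed
  show "(\<Sum>i. c t i) = (\<Sum>i. cin i) \<and> (\<Sum>i. real i * c t i) = (\<Sum>i. real i * cin i)"
  proof
    have "(\<lambda>i. 1 * c t i) sums (\<Sum>i. 1 * cin i)"
      by (rule moment) (use summ0 in auto)
    \<comment> \<open>The \<open>sums\<close> fact includes convergence, so the series on the left
      is a genuine limit.\<close>
    then show "(\<Sum>i. c t i) = (\<Sum>i. cin i)" by (simp add: sums_iff)
    have "(\<lambda>i. real i * c t i) sums (\<Sum>i. real i * cin i)"
      by (rule moment) (use summ1 in auto)
    then show "(\<Sum>i. real i * c t i) = (\<Sum>i. real i * cin i)" by (simp add: sums_iff)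
  qed
qed

end
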